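(* Let $m\ge2$, let $H$ be a complex Hilbert space, let $E$ be a POVM on $\Omega_m=\{0,\dots,m-1\}^{\mathbb N}$ with values in $B(H)$, and let $A_w^{(j)}\in B(H_w)$ be its splitting operators. For every finite word $w$ put $$N_w=I_{H_w}-\sum_{j=0}^{m-1}(A_w^{(j)})^2=\sum_{j=0}^{m-1}\big(A_w^{(j)}-(A_w^{(j)})^2\big).$$ Then $N_w\ge0$ for every finite word $w$. Moreover, $N_w=0$ if and only if $A_w^{(j)}$ is an orthogonal projection for every $0\le j\le m-1$. Consequently, $E$ is projection-valued if and only if $N_w=0$ for every finite word $w$.
   Context: $\Omega_m$ carries its product Borel $\sigma$-algebra $\mathcal B(\Omega_m)$. For a finite word $w=w_1\cdots w_n$ in $\{0,\dots,m-1\}$, $[w]=\{x\in\Omega_m:x_1=w_1,\dots,x_n=w_n\}$; the empty word is $\varnothing$, and $[\varnothing]=\Omega_m$; $wj$ is $w$ with the letter $j$ appended. A POVM on $\Omega_m$ with values in $B(H)$ is a map $E:\mathcal B(\Omega_m)\to B(H)_+$ that is countably additive in the weak operator topology and satisfies $E(\Omega_m)=I$; it is projection-valued if $E(B)$ is an orthogonal projection for every Borel set $B$. Put $E_w=E([w])$ and $H_w=\overline{\operatorname{ran}}(E_w^{1/2})$. The splitting operators of $E$ at $w$ are the unique positive contractions $A_w^{(0)},\dots,A_w^{(m-1)}\in B(H_w)$ with $\sum_{j=0}^{m-1}A_w^{(j)}=I_{H_w}$ and $E_{wj}=E_w^{1/2}A_w^{(j)}E_w^{1/2}$ for all $j$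 (with $A_w^{(j)}$ extended by zero on $H_w^\perp$). *)

theory Defs
  imports "HOL-Analysis.Analysis"
begin

section \<open>Complex Hilbert spaces\<close>

text \<open>
  The real structure of \<open>real_inner\<close> is the one underlying the complex structure: the real
  inner product is the real part of the complex one. Positive definiteness and
  \<open>norm x = sqrt (Re (cinner x x))\<close> are thus inherited from \<open>real_inner\<close>. The inner product
  is linear in its second argument.
\<close>

class chilbert_space = real_inner + complete_space +
  fixes scaleC :: "complex \<Rightarrow> 'a \<Rightarrow> 'a" (infixr \<open>*\<^sub>C\<close> 75)
    and cinner :: "'a \<Rightarrow> 'a \<Rightarrow> complex"
  assumes scaleC_of_real: "complex_of_real r *\<^sub>C x = r *\<^sub>R x"
    and scaleC_add_right: "a *\<^sub>C (x + y) = a *\<^sub>C x + a *\<^sub>C y"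
    and scaleC_add_left: "(a + b) *\<^sub>C x = a *\<^sub>C x + b *\<^sub>C x"
    and scaleC_scaleC: "a *\<^sub>C (b *\<^sub>C x) = (a * b) *\<^sub>C x"
    and cinner_commute: "cinner x y = cnj (cinner y x)"
    and cinner_add_right: "cinner x (y + z) = cinner x y + cinner x z"
    and cinner_scaleC_right: "cinner x (a *\<^sub>C y) = a * cinner x y"
    and inner_eq_Re_cinner: "inner x y = Re (cinner x y)"

section \<open>Bounded operators\<close>

text \<open>
  \<open>'a \<Rightarrow>\<^sub>L 'a\<close> is the type of bounded \<^emph>\<open>real\<close>-linear maps; \<open>B(H)\<close> consists of those
  satisfying \<open>clinear_op\<close>. The operator norm does not depend on the scalar field.
\<close>

definition clinear_op :: "('a::chilbert_space \<Rightarrow>\<^sub>L 'a) \<Rightarrow> bool" where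
  "clinear_op T \<longleftrightarrow> (\<forall>c x. blinfun_apply T (c *\<^sub>C x) = c *\<^sub>C blinfun_apply T x)"

definition positive_op :: "('a::chilbert_space \<Rightarrow>\<^sub>L 'a) \<Rightarrow> bool" where
  "positive_op T \<longleftrightarrow> clinear_op T \<and> (\<forall>x. cinner x (blinfun_apply T x) \<in> \<real>\<^sub>\<ge>\<^sub>0)"

definition orth_projection :: "('a::chilbert_space \<Rightarrow>\<^sub>L 'a) \<Rightarrow> bool" where
  "orth_projection P \<longleftrightarrow> clinear_op P \<and> P o\<^sub>L P = P \<and>
     (\<forall>x y. cinner (blinfun_apply P x) y = cinner x (blinfun_apply P y))"

definition op_sqrt :: "('a::chilbert_space \<Rightarrow>\<^sub>L 'a) \<Rightarrow> ('a \<Rightarrow>\<^sub>L 'a)" where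
  "op_sqrt T = (THE S. positive_op S \<and> S o\<^sub>L S = T)"

definition ortho_compl :: "'a::chilbert_space set \<Rightarrow> 'a set" where
  "ortho_compl K = {x. \<forall>y\<in>K. cinner y x = 0}"

text \<open>
  For a closed subspace \<open>K\<close> of \<open>H\<close>, an element of \<open>B(K)\<close> is represented by its extension by
  zero on the orthogonal complement of \<open>K\<close>. This embedding of \<open>B(K)\<close> into \<open>B(H)\<close> preserves
  and reflects sums, products, norms, positivity and being an orthogonal projection. The
  identity of \<open>B(K)\<close> is represented by the orthogonal projection of \<open>H\<close> onto \<open>K\<close>.
\<close>

definition op_on :: "'a::chilbert_space set \<Rightarrow> ('a \<Rightarrow>\<^sub>L 'a) \<Rightarrow> bool" where
  "op_on K T \<longleftrightarrow> clinear_op T \<and> range (blinfun_apply T) \<subseteq> K \<and>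
     (\<forall>x\<in>ortho_compl K. blinfun_apply T x = 0)"

definition id_on :: "'a::chilbert_space set \<Rightarrow> ('a \<Rightarrow>\<^sub>L 'a)" where
  "id_on K = (THE P. orth_projection P \<and> range (blinfun_apply P) = K)"

section \<open>Operator-valued measures on the sequence space\<close>

text \<open>Sequences are indexed from \<open>0\<close>, and words are lists over \<open>{..<m}\<close>.\<close>

definition Omega :: "nat \<Rightarrow> (nat \<Rightarrow> nat) measure" where
  "Omega m = (\<Pi>\<^sub>M i\<in>UNIV. count_space {..<m})"

definition cylinder :: "nat \<Rightarrow> nat list \<Rightarrow> (nat \<Rightarrow> nat) set" where
  "cylinder m w = {x \<in> space (Omega m). \<forall>i<length w. x i = w ! i}"

definition povm :: "nat \<Rightarrow> ((nat \<Rightarrow> nat) set \<Rightarrow> ('a::chilbert_space \<Rightarrow>\<^sub>L 'a)) \<Rightarrow> bool" where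
  "povm m E \<longleftrightarrow>
     (\<forall>B\<in>sets (Omega m). positive_op (E B)) \<and>
     (\<forall>F :: nat \<Rightarrow> (nat \<Rightarrow> nat) set. range F \<subseteq> sets (Omega m) \<longrightarrow> disjoint_family F \<longrightarrow>
        (\<forall>x y. (\<lambda>n. cinner x (blinfun_apply (E (F n)) y)) sums
               cinner x (blinfun_apply (E (\<Union>n. F n)) y))) \<and>
     E (space (Omega m)) = id_blinfun"

definition projection_valued ::
    "nat \<Rightarrow> ((nat \<Rightarrow> nat) set \<Rightarrow> ('a::chilbert_space \<Rightarrow>\<^sub>L 'a)) \<Rightarrow> bool" where
  "projection_valued m E \<longleftrightarrow> (\<forall>B\<in>sets (Omega m). orth_projection (E B))"

definition cyl_sqrt ::
    "nat \<Rightarrow> ((nat \<Rightarrow> nat) set \<Rightarrow> ('a::chilbert_space \<Rightarrow>\<^sub>L 'a)) \<Rightarrow> nat list \<Rightarrow> ('a \<Rightarrow>\<^sub>L 'a)" where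
  "cyl_sqrt m E w = op_sqrt (E (cylinder m w))"

definition cyl_space ::
    "nat \<Rightarrow> ((nat \<Rightarrow> nat) set \<Rightarrow> ('a::chilbert_space \<Rightarrow>\<^sub>L 'a)) \<Rightarrow> nat list \<Rightarrow> 'a set" where
  "cyl_space m E w = closure (range (blinfun_apply (cyl_sqrt m E w)))"

section \<open>Splitting operators\<close>

text \<open>
  \<open>A w j\<close> is the splitting operator at the word \<open>w\<close> for the letter \<open>j\<close>. The conditions
  determine it for \<open>w\<close> over \<open>{..<m}\<close> and \<open>j < m\<close>; its other values are irrelevant.
\<close>

definition splitting_operators ::
    "nat \<Rightarrow> ((nat \<Rightarrow> nat) set \<Rightarrow> ('a::chilbert_space \<Rightarrow>\<^sub>L 'a)) \<Rightarrow>
     (nat list \<Rightarrow> nat \<Rightarrow> ('a \<Rightarrow>\<^sub>L 'a)) \<Rightarrow> bool" where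
  "splitting_operators m E A \<longleftrightarrow> (\<forall>w\<in>lists {..<m}.
     (\<forall>j<m. op_on (cyl_space m E w) (A w j) \<and> positive_op (A w j) \<and> norm (A w j) \<le> 1) \<and>
     (\<Sum>j<m. A w j) = id_on (cyl_space m E w) \<and>
     (\<forall>j<m. E (cylinder m (w @ [j])) = cyl_sqrt m E w o\<^sub>L A w j o\<^sub>L cyl_sqrt m E w))"

definition splitting_defect ::
    "nat \<Rightarrow> ((nat \<Rightarrow> nat) set \<Rightarrow> ('a::chilbert_space \<Rightarrow>\<^sub>L 'a)) \<Rightarrow>
     (nat list \<Rightarrow> nat \<Rightarrow> ('a \<Rightarrow>\<^sub>L 'a)) \<Rightarrow> nat list \<Rightarrow> ('a \<Rightarrow>\<^sub>L 'a)" where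
  "splitting_defect m E A w = id_on (cyl_space m E w) - (\<Sum>j<m. A w j o\<^sub>L A w j)"

end

theory Submission
  imports Defs
begin

text \<open>
  For a positive contraction \<open>T\<close> the Cauchy--Schwarz inequality for the form
  \<open>\<langle>x, Ty\<rangle>\<close> gives \<open>\<parallel>Tx\<parallel>\<^sup>2 \<le> \<langle>x, Tx\<rangle>\<close>, so that \<open>T - T\<^sup>2\<close> is positive. The defect at a word is
  the sum of these positive operators over the splitting operators; it is therefore positive,
  and it vanishes exactly when each summand does, that is, when each splitting operator is
  idempotent.

  For the last equivalence, suppose that \<open>P = E [w]\<close> is a projection. It is its own positive square
  root (\<open>op_sqrt_projection\<close>) and its range is closed, so the splitting operators at \<open>w\<close> live on
  the range of \<open>P\<close> and \<open>E [wj] = P A P = A\<close> for the splitting operator \<open>A\<close> of the letter \<open>j\<close>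
  (\<open>splitting_operators_eq_measure\<close>). If \<open>E\<close> is projection-valued, all splitting operators are
  thus projections. Conversely, if all splitting operators are projections, then induction on
  the length of the word, starting from \<open>E \<Omega> = I\<close>, shows that \<open>E\<close> is a projection on every
  cylinder. In particular, square roots of positive operators other than projections play no role.

  The step from cylinders to all Borel sets (\<open>povm_projection_sigma_algebra\<close>) rests on the identity
  \<open>E B E C = E (B \<inter> C)\<close>, valid for every Borel set \<open>B\<close> as soon as \<open>E C\<close> is a projection. By
  this identity, the sets on which \<open>E\<close> is a projection are closed under intersections and
  countable disjoint unions, so they form a \<open>\<sigma>\<close>-algebra.
\<close>

section \<open>Positive operators and projections on a complex Hilbert space\<close>

lemma cinner_add_left: "cinner (x + y) (z::'a::chilbert_space) = cinner x z + cinner y z"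
  by (metis cinner_add_right cinner_commute complex_cnj_add)

lemma cinner_scaleC_left: "cinner (a *\<^sub>C x) (y::'a::chilbert_space) = cnj a * cinner x y"
  by (metis cinner_commute cinner_scaleC_right complex_cnj_mult)

lemma scaleC_minus1: "(-1) *\<^sub>C x = - (x::'a::chilbert_space)"
  using scaleC_of_real[of "-1" x] by simp

lemma scaleC_minus_right: "c *\<^sub>C (- x) = - (c *\<^sub>C (x::'a::chilbert_space))"
  by (metis scaleC_minus1 scaleC_scaleC mult.commute)

lemma scaleC_diff_right: "c *\<^sub>C (x - y) = c *\<^sub>C x - c *\<^sub>C (y::'a::chilbert_space)"
  using scaleC_add_right[of c x "- y"] by (simp add: scaleC_minus_right)

lemma cinner_minus_right: "cinner x (- y) = - cinner x (y::'a::chilbert_space)"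
  using cinner_scaleC_right[of x "-1" y] by (simp add: scaleC_minus1)

lemma cinner_diff_right: "cinner x (y - z) = cinner x y - cinner x (z::'a::chilbert_space)"
  using cinner_add_right[of x y "- z"] by (simp add: cinner_minus_right)

lemma cinner_diff_left: "cinner (x - y) (z::'a::chilbert_space) = cinner x z - cinner y z"
  by (metis cinner_diff_right cinner_commute complex_cnj_diff)

lemma scaleC_zero_right [simp]: "c *\<^sub>C 0 = (0::'a::chilbert_space)"
  using scaleC_add_right[of c 0 0] by simp

lemma cinner_zero_right [simp]: "cinner x (0::'a::chilbert_space) = 0"
  using cinner_add_right[of x 0 0] by simp

lemma cinner_self: "cinner x (x::'a::chilbert_space) = of_real ((norm x)\<^sup>2)"
proof -
  have "Im (cinner x x) = 0"
    using cinner_commute[of x x] by (metis Reals_cnj_iff complex_is_Real_iff)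
  then show ?thesis
    by (simp add: complex_eq_iff power2_norm_eq_inner inner_eq_Re_cinner)
qed

lemma eq_zero_if_cinner_zero:
  fixes x :: "'a::chilbert_space"
  assumes "\<And>y. cinner y x = 0"
  shows "x = 0"
  using assms[of x] by (simp add: cinner_self)

lemma eq_if_cinner_eq:
  fixes x y :: "'a::chilbert_space"
  assumes "\<And>z. cinner z x = cinner z y"
  shows "x = y"
  using eq_zero_if_cinner_zero[of "x - y"] assms by (simp add: cinner_diff_right)

lemma positive_op_clinear: "positive_op T \<Longrightarrow> clinear_op T"
  by (simp add: positive_op_def)

lemma positive_op_inner_nonneg: "positive_op T \<Longrightarrow> 0 \<le> inner x (T x)"
  by (simp add: positive_op_def inner_eq_Re_cinner complex_nonneg_Reals_iff)

text \<open>
  Polarization: over the complex numbers a real quadratic form forces self-adjointness.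
\<close>

lemma positive_op_selfadjoint:
  fixes T :: "'a::chilbert_space \<Rightarrow>\<^sub>L 'a"
  assumes "positive_op T"
  shows "cinner (T x) y = cinner x (T y)"
proof -
  have im: "Im (cinner z (T z)) = 0" for z
    using assms by (simp add: positive_op_def complex_nonneg_Reals_iff)
  have lin: "T (c *\<^sub>C z) = c *\<^sub>C T z" for c z
    using assms by (simp add: positive_op_def clinear_op_def)
  have 1: "Im (cinner x (T z)) + Im (cinner z (T x)) = 0" for z
    using im[of "x + z"] im[of x] im[of z]
    by (simp add: blinfun.add_right cinner_add_left cinner_add_right)
  have 2: "Re (cinner x (T y)) - Re (cinner y (T x)) = 0"
    using 1[of "\<i> *\<^sub>C y"] by (simp add: lin cinner_scaleC_left cinner_scaleC_right)
  have "cinner x (T y) = cnj (cinner y (T x))"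
    using 1[of y] 2 by (simp add: complex_eq_iff)
  then show ?thesis
    using cinner_commute[of "T x" y] by simp
qed

lemma positive_op_inner_selfadjoint:
  "positive_op T \<Longrightarrow> inner (T x) y = inner x (T y)"
  by (simp add: inner_eq_Re_cinner positive_op_selfadjoint)

text \<open>
  The case \<open>y = T x\<close> of the Cauchy--Schwarz inequality for the positive semidefinite form
  \<open>inner x (T y)\<close>, with \<open>inner y (T y)\<close> bounded by the operator norm.
\<close>

lemma positive_op_norm_sq_le:
  fixes T :: "'a::chilbert_space \<Rightarrow>\<^sub>L 'a"
  assumes T: "positive_op T"
  shows "(norm (T x))\<^sup>2 \<le> norm T * inner x (T x)"
proof (cases "norm T = 0")
  case True
  then show ?thesis by simp
next
  case False
  define v where "v = T x"
  define t where "t = inverse (norm T)"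
  have pos: "norm T > 0" using False by simp
  have tT: "t * norm T = 1" using pos by (simp add: t_def)
  have Tv: "inner v (T v) \<le> norm T * (norm v)\<^sup>2"
  proof -
    have "inner v (T v) \<le> norm v * norm (T v)" by (rule norm_cauchy_schwarz)
    also have "\<dots> \<le> norm v * (norm T * norm v)"
      by (intro mult_left_mono norm_blinfun) simp
    finally show ?thesis by (simp add: power2_eq_square mult_ac)
  qed
  \<comment> \<open>The choice of \<open>t\<close> minimizes the upper bound \<open>inner x v - 2 t |v|^2 + t^2 |T| |v|^2\<close>.\<close>
  have xv: "inner x (T v) = (norm v)\<^sup>2"
    using positive_op_inner_selfadjoint[OF T, of x v] by (simp add: v_def power2_norm_eq_inner)
  have "0 \<le> inner (x - t *\<^sub>R v) (T (x - t *\<^sub>R v))"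
    by (rule positive_op_inner_nonneg[OF T])
  also have "\<dots> = inner x v - 2 * t * (norm v)\<^sup>2 + t\<^sup>2 * inner v (T v)"
    by (simp add: blinfun.diff_right blinfun.scaleR_right inner_diff_left inner_diff_right
        xv power2_norm_eq_inner[of v, symmetric] power2_eq_square[of t] algebra_simps
        flip: v_def)
  also have "\<dots> \<le> inner x v - 2 * t * (norm v)\<^sup>2 + t\<^sup>2 * (norm T * (norm v)\<^sup>2)"
    by (intro add_left_mono mult_left_mono Tv) simp
  also have "\<dots> = inner x v - t * (norm v)\<^sup>2"
    using tT by (simp add: power2_eq_square algebra_simps)
  finally have "norm T * (t * (norm v)\<^sup>2) \<le> norm T * inner x v"
    using pos by (intro mult_left_mono) auto
  moreover have "norm T * (t * (norm v)\<^sup>2) = (norm v)\<^sup>2"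
    using tT by (simp add: mult.commute[of t] flip: mult.assoc)
  ultimately have "(norm v)\<^sup>2 \<le> norm T * inner x v" by linarith
  then show ?thesis by (simp only: v_def)
qed

lemma positive_op_eq_zero_if_inner_zero:
  assumes "positive_op T" and "inner x (T x) = 0"
  shows "T x = 0"
  using positive_op_norm_sq_le[OF assms(1), of x] assms(2) by simp

lemma positive_op_add:
  "positive_op S \<Longrightarrow> positive_op T \<Longrightarrow> positive_op (S + T)"
  by (auto simp: positive_op_def clinear_op_def blinfun.add_left scaleC_add_right cinner_add_right
      intro: nonneg_Reals_add_I)

lemma positive_op_zero: "positive_op 0"
  by (simp add: positive_op_def clinear_op_def)

lemma positive_op_sum:
  "(\<And>i. i \<in> I \<Longrightarrow> positive_op (T i)) \<Longrightarrow> positive_op (\<Sum>i\<in>I. T i)"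
  by (induction I rule: infinite_finite_induct) (auto intro: positive_op_add positive_op_zero)

text \<open>
  The quadratic forms of the summands are nonnegative and add up to zero, so each vanishes.
\<close>

lemma positive_sum_eq_zero:
  assumes fin: "finite I" and T: "\<And>i. i \<in> I \<Longrightarrow> positive_op (T i)"
    and sum0: "(\<Sum>i\<in>I. T i) = 0" and i: "i \<in> I"
  shows "T i = 0"
proof (rule blinfun_eqI)
  fix x
  have "(\<Sum>i\<in>I. inner x (T i x)) = inner x ((\<Sum>i\<in>I. T i) x)"
    by (simp add: blinfun.sum_left inner_sum_right)
  then have "(\<Sum>i\<in>I. inner x (T i x)) = 0"
    using sum0 by simp
  then have "inner x (T i x) = 0"
    using fin i positive_op_inner_nonneg[OF T] by (simp add: sum_nonneg_eq_0_iff)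
  then show "T i x = blinfun_apply 0 x"
    using positive_op_eq_zero_if_inner_zero[OF T[OF i]] by simp
qed

lemma positive_op_minus_square:
  assumes T: "positive_op T" and contr: "norm T \<le> 1"
  shows "positive_op (T - (T o\<^sub>L T))"
  unfolding positive_op_def
proof (intro conjI allI)
  show "clinear_op (T - (T o\<^sub>L T))"
    using positive_op_clinear[OF T]
    by (simp add: clinear_op_def blinfun.diff_left scaleC_diff_right)
  fix x
  have "(norm (T x))\<^sup>2 \<le> norm T * inner x (T x)"
    by (rule positive_op_norm_sq_le[OF T])
  also have "\<dots> \<le> 1 * inner x (T x)"
    by (rule mult_right_mono[OF contr positive_op_inner_nonneg[OF T]])
  finally have "(norm (T x))\<^sup>2 \<le> Re (cinner x (T x))"
    by (simp add: inner_eq_Re_cinner)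
  moreover have "cinner x (T (T x)) = of_real ((norm (T x))\<^sup>2)"
    by (metis cinner_self positive_op_selfadjoint[OF T])
  moreover have "Im (cinner x (T x)) = 0"
    using T by (simp add: positive_op_def complex_nonneg_Reals_iff)
  ultimately show "cinner x ((T - (T o\<^sub>L T)) x) \<in> \<real>\<^sub>\<ge>\<^sub>0"
    by (simp add: blinfun.diff_left cinner_diff_right complex_nonneg_Reals_iff)
qed

lemma orth_projection_positive:
  assumes "orth_projection P"
  shows "positive_op P"
  unfolding positive_op_def
proof (intro conjI allI)
  show "clinear_op P" using assms by (simp add: orth_projection_def)
  fix x
  have "P (P x) = P x"
    using assms by (metis orth_projection_def blinfun_apply_blinfun_compose)
  then have "cinner x (P x) = cinner (P x) (P x)"
    using assms by (metis orth_projection_def)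
  then show "cinner x (P x) \<in> \<real>\<^sub>\<ge>\<^sub>0"
    by (simp add: cinner_self)
qed

lemma orth_projection_iff: "orth_projection P \<longleftrightarrow> positive_op P \<and> P o\<^sub>L P = P"
  using orth_projection_positive positive_op_selfadjoint positive_op_clinear
  unfolding orth_projection_def by blast

lemma orth_projection_idem: "orth_projection P \<Longrightarrow> P (P x) = P x"
  by (metis orth_projection_def blinfun_apply_blinfun_compose)

lemma orth_projection_selfadjoint:
  "orth_projection P \<Longrightarrow> cinner (P x) y = cinner x (P y)"
  by (simp add: orth_projection_def)

lemma orth_projection_range:
  assumes "orth_projection P"
  shows "range (blinfun_apply P) = {x. P x = x}"
  using orth_projection_idem[OF assms] by (auto simp: image_iff intro: sym)

lemma orth_projection_closed_range:
  assumes "orth_projection P"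
  shows "closure (range (blinfun_apply P)) = range (blinfun_apply P)"
proof (rule closure_closed)
  have "closed {x. P x = x}"
    by (intro closed_Collect_eq continuous_intros)
  then show "closed (range (blinfun_apply P))"
    by (simp only: orth_projection_range[OF assms])
qed

lemma orth_projection_compl:
  assumes "orth_projection P"
  shows "orth_projection (id_blinfun - P)"
proof -
  have "cinner (x - P x) y = cinner x (y - P y)" for x y
    by (simp add: cinner_diff_left cinner_diff_right orth_projection_selfadjoint[OF assms])
  moreover have "clinear_op (id_blinfun - P)"
    using assms by (simp add: orth_projection_def clinear_op_def blinfun.diff_left
        scaleC_diff_right)
  moreover have "(id_blinfun - P) o\<^sub>L (id_blinfun - P) = id_blinfun - P"
    by (rule blinfun_eqI)
      (simp add: blinfun.diff_left blinfun.diff_right orth_projection_idem[OF assms])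
  ultimately show ?thesis
    by (simp add: orth_projection_def blinfun.diff_left)
qed

lemma orth_projection_id: "orth_projection id_blinfun"
  by (auto simp: orth_projection_def clinear_op_def intro!: blinfun_eqI)

text \<open>
  A projection is its own positive square root. For another positive root \<open>S\<close> and
  \<open>D = S - P\<close>, one has \<open>(S + P) D = 0\<close> since \<open>S\<close> commutes with \<open>P\<close>; hence the nonnegative
  numbers \<open>\<langle>Dx, SDx\<rangle>\<close> and \<open>\<langle>Dx, PDx\<rangle>\<close> add up to zero.
\<close>

lemma op_sqrt_projection:
  fixes P :: "'a::chilbert_space \<Rightarrow>\<^sub>L 'a"
  assumes P: "orth_projection P"
  shows "op_sqrt P = P"
  unfolding op_sqrt_def
proof (rule the_equality)
  show "positive_op P \<and> P o\<^sub>L P = P"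
    using P by (simp add: orth_projection_iff)
  fix S :: "'a \<Rightarrow>\<^sub>L 'a"
  assume "positive_op S \<and> S o\<^sub>L S = P"
  then have S: "positive_op S" and SS: "S o\<^sub>L S = P" by auto
  have SSx: "S (S x) = P x" for x
    using SS by (metis blinfun_apply_blinfun_compose)
  have PP: "P (P x) = P x" for x by (rule orth_projection_idem[OF P])
  show "S = P"
  proof (rule blinfun_eqI)
    fix x
    define d where "d = S x - P x"
    have comm: "P (S x) = S (P x)" by (simp flip: SSx)
    have sum: "S d + P d = 0"
      by (simp add: d_def blinfun.diff_right SSx PP comm)
    have pos: "0 \<le> inner d (S d)" "0 \<le> inner d (P d)"
      using S orth_projection_positive[OF P] by (auto intro: positive_op_inner_nonneg)
    have "inner d (S d) + inner d (P d) = 0"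
      using sum by (simp flip: inner_add_right)
    then have "inner d (S d) = 0" "inner d (P d) = 0" using pos by linarith+
    then have Sd: "S d = 0" and Pd: "P d = 0"
      using S orth_projection_positive[OF P] by (auto intro: positive_op_eq_zero_if_inner_zero)
    have "inner d d = inner (S x) d - inner (P x) d"
      by (simp add: d_def inner_diff_left)
    also have "\<dots> = inner x (S d) - inner x (P d)"
      using S orth_projection_positive[OF P] by (simp add: positive_op_inner_selfadjoint)
    finally have "d = 0" using Sd Pd by simp
    then show "S x = P x" by (simp add: d_def)
  qed
qed

text \<open>
  An operator on the range of \<open>P\<close>, extended by zero, is unchanged by compression with \<open>P\<close>.
\<close>

lemma op_on_range_compress:
  assumes P: "orth_projection P" and T: "op_on (range (blinfun_apply P)) T"
  shows "P o\<^sub>L T o\<^sub>L P = T"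
proof (rule blinfun_eqI)
  fix x
  have PT: "P (T y) = T y" for y
    using T orth_projection_range[OF P] unfolding op_on_def by blast
  have "x - P x \<in> ortho_compl (range (blinfun_apply P))"
    by (auto simp: ortho_compl_def orth_projection_selfadjoint[OF P] blinfun.diff_right
        orth_projection_idem[OF P] cinner_diff_right)
  then have "T (x - P x) = 0" using T by (simp add: op_on_def)
  then have "T (P x) = T x" by (simp add: blinfun.diff_right)
  then show "(P o\<^sub>L T o\<^sub>L P) x = T x" by (simp add: PT)
qed

section \<open>Operator-valued measures\<close>

lemma povm_positive: "povm m E \<Longrightarrow> B \<in> sets (Omega m) \<Longrightarrow> positive_op (E B)"
  by (simp add: povm_def)

lemma povm_space: "povm m E \<Longrightarrow> E (space (Omega m)) = id_blinfun"
  by (simp add: povm_def)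

lemma povm_sums:
  fixes F :: "nat \<Rightarrow> (nat \<Rightarrow> nat) set"
  assumes "povm m E" "range F \<subseteq> sets (Omega m)" "disjoint_family F"
  shows "(\<lambda>n. cinner x (E (F n) y)) sums cinner x (E (\<Union>n. F n) y)"
  using assms by (simp add: povm_def)

lemma povm_empty:
  assumes E: "povm m E"
  shows "E {} = 0"
proof (rule blinfun_eqI)
  fix y
  have "cinner x (E {} y) = 0" for x
  proof -
    have "(\<lambda>n::nat. cinner x (E {} y)) sums cinner x (E {} y)"
      using povm_sums[OF E, of "\<lambda>_. {}" x y] by (simp add: disjoint_family_on_def)
    then show ?thesis
      by (metis summable_const_iff sums_summable)
  qed
  then show "E {} y = blinfun_apply 0 y"
    by (simp add: eq_zero_if_cinner_zero)
qed

lemma povm_Un: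
  assumes E: "povm m E" and B: "B \<in> sets (Omega m)" and C: "C \<in> sets (Omega m)"
    and disj: "B \<inter> C = {}"
  shows "E (B \<union> C) = E B + E C"
proof (intro blinfun_eqI eq_if_cinner_eq)
  fix y z
  have "range (binaryset B C) \<subseteq> sets (Omega m)"
    using B C by (auto simp: range_binaryset_eq)
  moreover have "disjoint_family (binaryset B C)"
    using disj by (auto simp: disjoint_family_on_def binaryset_def)
  ultimately have "(\<lambda>n. cinner z (E (binaryset B C n) y)) sums cinner z (E (B \<union> C) y)"
    using povm_sums[OF E, of "binaryset B C" z y] by (simp add: UN_binaryset_eq)
  moreover have "(\<lambda>n. cinner z (E (binaryset B C n) y)) sums (cinner z (E B y) + cinner z (E C y))"
    using binaryset_sums[of "\<lambda>S. cinner z (E S y)" B C] by (simp add: povm_empty[OF E])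
  ultimately show "cinner z (E (B \<union> C) y) = cinner z ((E B + E C) y)"
    using sums_unique2 by (fastforce simp: blinfun.add_left cinner_add_right)
qed

lemma povm_compl:
  assumes E: "povm m E" and C: "C \<in> sets (Omega m)"
  shows "E (space (Omega m) - C) = id_blinfun - E C"
proof -
  have "E (C \<union> (space (Omega m) - C)) = E C + E (space (Omega m) - C)"
    using C by (intro povm_Un[OF E]) auto
  moreover have "C \<union> (space (Omega m) - C) = space (Omega m)"
    using sets.sets_into_space[OF C] by auto
  ultimately show ?thesis using povm_space[OF E] by (simp add: algebra_simps)
qed

text \<open>Since \<open>0 \<le> E B \<le> E C\<close>, the kernel of the projection \<open>E C\<close> lies in that of \<open>E B\<close>.\<close>

lemma povm_subset_projection:
  assumes E: "povm m E" and B: "B \<in> sets (Omega m)" and C: "C \<in> sets (Omega m)"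
    and sub: "B \<subseteq> C" and P: "orth_projection (E C)"
  shows "E B (E C x) = E B x"
proof -
  define z where "z = x - E C x"
  have DC: "C - B \<in> sets (Omega m)" using B C by auto
  have "E C = E B + E (C - B)"
    using povm_Un[OF E B DC] sub by (simp add: Un_absorb1)
  moreover have "E C z = 0"
    by (simp add: z_def blinfun.diff_right orth_projection_idem[OF P])
  ultimately have "E B z + E (C - B) z = 0"
    by (simp add: blinfun.add_left)
  then have "inner z (E B z) + inner z (E (C - B) z) = 0"
    by (simp flip: inner_add_right)
  moreover have "0 \<le> inner z (E B z)" "0 \<le> inner z (E (C - B) z)"
    using povm_positive[OF E] B DC by (auto intro: positive_op_inner_nonneg)
  ultimately have "inner z (E B z) = 0" by linarith
  then have "E B z = 0"
    using positive_op_eq_zero_if_inner_zero povm_positive[OF E B] by blast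
  then show ?thesis by (simp add: z_def blinfun.diff_right)
qed

text \<open>
  Multiplicativity needs only one of the two values to be a projection: the part of \<open>B\<close>
  inside \<open>C\<close> is absorbed by \<open>E C\<close>, and the part outside is annihilated by it.
\<close>

lemma povm_Int_projection:
  assumes E: "povm m E" and B: "B \<in> sets (Omega m)" and C: "C \<in> sets (Omega m)"
    and P: "orth_projection (E C)"
  shows "E B (E C x) = E (B \<inter> C) x"
proof -
  let ?C' = "space (Omega m) - C"
  have BC: "B - C \<in> sets (Omega m)" "B \<inter> C \<in> sets (Omega m)" "?C' \<in> sets (Omega m)"
    using B C by auto
  have "E ((B \<inter> C) \<union> (B - C)) = E (B \<inter> C) + E (B - C)"
    using BC by (intro povm_Un[OF E]) auto
  then have split: "E B = E (B \<inter> C) + E (B - C)"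
    by (simp add: Int_Diff_Un)
  have P': "orth_projection (E ?C')"
    using orth_projection_compl[OF P] by (simp add: povm_compl[OF E C])
  have sub: "B - C \<subseteq> ?C'" using sets.sets_into_space[OF B] by auto
  have "E (B - C) (E ?C' x) = E (B - C) x"
    by (rule povm_subset_projection[OF E BC(1) BC(3) sub P'])
  then have "E (B - C) (E C x) = 0"
    by (simp add: povm_compl[OF E C] blinfun.diff_left blinfun.diff_right)
  moreover have "E (B \<inter> C) (E C x) = E (B \<inter> C) x"
    by (rule povm_subset_projection[OF E BC(2) C _ P]) simp
  ultimately show ?thesis by (simp add: split blinfun.add_left)
qed

lemma povm_projection_Int:
  assumes E: "povm m E" and B: "B \<in> sets (Omega m)" and C: "C \<in> sets (Omega m)"
    and PB: "orth_projection (E B)" and PC: "orth_projection (E C)"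
  shows "orth_projection (E (B \<inter> C))"
proof -
  have BC: "E (B \<inter> C) x = E B (E C x)" for x
    by (rule povm_Int_projection[OF E B C PC, symmetric])
  have CB: "E (B \<inter> C) x = E C (E B x)" for x
    using povm_Int_projection[OF E C B PB, of x] by (simp add: Int_commute)
  have "E (B \<inter> C) (E (B \<inter> C) x) = E (B \<inter> C) x" for x
  proof -
    have "E (B \<inter> C) (E (B \<inter> C) x) = E C (E B (E B (E C x)))"
      using CB[of "E (B \<inter> C) x"] by (simp only: BC[of x])
    also have "\<dots> = E C (E B (E C x))"
      by (simp only: orth_projection_idem[OF PB])
    also have "\<dots> = E C (E C (E B x))"
      by (simp only: BC[symmetric] CB)
    also have "\<dots> = E (B \<inter> C) x"
      by (simp only: orth_projection_idem[OF PC] CB[of x])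
    finally show ?thesis .
  qed
  moreover have "positive_op (E (B \<inter> C))"
    using B C by (intro povm_positive[OF E]) auto
  ultimately show ?thesis
    by (auto simp: orth_projection_iff intro!: blinfun_eqI)
qed

text \<open>
  The union \<open>U\<close> satisfies \<open>E U E (F n) = E (F n)\<close> for all \<open>n\<close>; summing over \<open>n\<close> in the weak
  operator topology yields \<open>E U E U = E U\<close>.
\<close>

lemma povm_projection_UN:
  fixes F :: "nat \<Rightarrow> (nat \<Rightarrow> nat) set"
  assumes E: "povm m E" and F: "range F \<subseteq> sets (Omega m)" and disj: "disjoint_family F"
    and P: "\<And>n. orth_projection (E (F n))"
  shows "orth_projection (E (\<Union>n. F n))"
proof -
  let ?U = "\<Union>n. F n"
  have U: "?U \<in> sets (Omega m)" using F by auto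
  have pos: "positive_op (E ?U)" by (rule povm_positive[OF E U])
  have absorb: "E ?U (E (F n) y) = E (F n) y" for n y
  proof -
    have "?U \<inter> F n = F n" by auto
    then show ?thesis
      using povm_Int_projection[OF E U _ P[of n], of y] F by auto
  qed
  have "E ?U (E ?U y) = E ?U y" for y
  proof (rule eq_if_cinner_eq)
    fix x
    have "(\<lambda>n. cinner (E ?U x) (E (F n) y)) sums cinner (E ?U x) (E ?U y)"
      by (rule povm_sums[OF E F disj])
    then have "(\<lambda>n. cinner x (E (F n) y)) sums cinner x (E ?U (E ?U y))"
      by (simp only: positive_op_selfadjoint[OF pos] absorb)
    then show "cinner x (E ?U (E ?U y)) = cinner x (E ?U y)"
      using povm_sums[OF E F disj, of x y] sums_unique2 by blast
  qed
  then show ?thesis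
    using pos by (auto simp: orth_projection_iff intro!: blinfun_eqI)
qed

lemma povm_projection_sigma_algebra:
  assumes E: "povm m E"
  shows "sigma_algebra (space (Omega m)) {B \<in> sets (Omega m). orth_projection (E B)}"
    (is "sigma_algebra ?S ?D")
proof -
  have "algebra ?S ?D"
    unfolding algebra_iff_Int
  proof (intro conjI ballI)
    show "?D \<subseteq> Pow ?S" using sets.sets_into_space by auto
    show "{} \<in> ?D"
      using povm_compl[OF E sets.top] povm_space[OF E] orth_projection_compl[OF orth_projection_id]
      by simp
    show "?S - B \<in> ?D" if "B \<in> ?D" for B
      using that povm_compl[OF E] orth_projection_compl by auto
    show "B \<inter> C \<in> ?D" if "B \<in> ?D" "C \<in> ?D" for B C
      using that povm_projection_Int[OF E] by auto
  qed
  moreover have "(\<Union>n. F n) \<in> ?D" if "range F \<subseteq> ?D" "disjoint_family F" for F :: "nat \<Rightarrow> _"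
  proof -
    have "range F \<subseteq> sets (Omega m)" "\<And>n. orth_projection (E (F n))" using that(1) by auto
    then show ?thesis using povm_projection_UN[OF E _ that(2)] by auto
  qed
  ultimately show ?thesis
    by (auto simp: sigma_algebra_disjoint_iff)
qed

section \<open>Cylinders and splitting operators\<close>

lemma space_Omega: "x \<in> space (Omega m) \<longleftrightarrow> (\<forall>i. x i < m)"
  by (auto simp: Omega_def space_PiM PiE_iff)

lemma cylinder_in_sets: "cylinder m w \<in> sets (Omega m)"
proof -
  have coord: "(\<lambda>x. x i) \<in> measurable (Omega m) (count_space {..<m})" for i
    unfolding Omega_def by (rule measurable_component_singleton) simp
  have "{x \<in> space (Omega m). x i = a} \<in> sets (Omega m)" for i a
  proof -
    have "{x \<in> space (Omega m). x i = a} = (\<lambda>x. x i) -` ({a} \<inter> {..<m}) \<inter> space (Omega m)"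
      by (auto simp: space_Omega)
    also have "\<dots> \<in> sets (Omega m)" by (rule measurable_sets[OF coord]) simp
    finally show ?thesis .
  qed
  then have "{x \<in> space (Omega m). \<forall>i\<in>{..<length w}. x i = w ! i} \<in> sets (Omega m)"
    by (intro sets.sets_Collect_finite_All) auto
  moreover have "cylinder m w = {x \<in> space (Omega m). \<forall>i\<in>{..<length w}. x i = w ! i}"
    by (auto simp: cylinder_def)
  ultimately show ?thesis by (simp only:)
qed

lemma cylinder_Nil: "cylinder m [] = space (Omega m)"
  by (simp add: cylinder_def)

text \<open>
  The coordinate sets, which generate the product \<open>\<sigma>\<close>-algebra, are countable unions of cylinders.
\<close>

lemma coordinate_set_eq_UN_cylinder:
  "{x \<in> space (Omega m). x i \<in> A} =
   (\<Union>w\<in>{w \<in> lists {..<m}. length w = Suc i \<and> w ! i \<in> A}. cylinder m w)" (is "?L = ?R")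
proof
  show "?R \<subseteq> ?L" by (auto simp: cylinder_def)
  show "?L \<subseteq> ?R"
  proof
    fix x assume x: "x \<in> ?L"
    let ?w = "map x [0..<Suc i]"
    have "x \<in> cylinder m ?w" using x by (auto simp: cylinder_def simp del: upt_Suc)
    moreover have "?w ! i = x i" by (simp add: nth_append)
    then have "?w \<in> {w \<in> lists {..<m}. length w = Suc i \<and> w ! i \<in> A}"
      using x by (auto simp: space_Omega)
    ultimately show "x \<in> ?R" by blast
  qed
qed

lemma projection_valued_if_cylinders:
  assumes E: "povm m E" and cyl: "\<And>w. w \<in> lists {..<m} \<Longrightarrow> orth_projection (E (cylinder m w))"
  shows "projection_valued m E"
proof -
  let ?D = "{B \<in> sets (Omega m). orth_projection (E B)}"
  interpret D: sigma_algebra "space (Omega m)" ?D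
    by (rule povm_projection_sigma_algebra[OF E])
  have coord: "{x \<in> space (Omega m). x i \<in> A} \<in> ?D" for i A
    unfolding coordinate_set_eq_UN_cylinder
    by (rule D.countable_UN') (use cyl cylinder_in_sets in auto)
  have "sets (Omega m) = sigma_sets (space (Omega m))
      {{x \<in> space (Omega m). x i \<in> A} | i A. A \<subseteq> {..<m}}"
    unfolding Omega_def sets_PiM_single by (simp add: space_PiM)
  also have "\<dots> \<subseteq> ?D"
    using coord by (intro D.sigma_sets_subset) blast
  finally show ?thesis by (auto simp: projection_valued_def)
qed

lemma splitting_operatorsD:
  assumes "splitting_operators m E A" and "w \<in> lists {..<m}"
  shows "(\<Sum>j<m. A w j) = id_on (cyl_space m E w)"
    and "j < m \<Longrightarrow> op_on (cyl_space m E w) (A w j)"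
    and "j < m \<Longrightarrow> positive_op (A w j)"
    and "j < m \<Longrightarrow> norm (A w j) \<le> 1"
    and "j < m \<Longrightarrow> E (cylinder m (w @ [j])) = cyl_sqrt m E w o\<^sub>L A w j o\<^sub>L cyl_sqrt m E w"
  using assms unfolding splitting_operators_def by blast+

text \<open>
  Where the measure of a cylinder is a projection, the splitting operators are the
  measures of its children.
\<close>

lemma splitting_operators_eq_measure:
  assumes A: "splitting_operators m E A" and w: "w \<in> lists {..<m}" and j: "j < m"
    and P: "orth_projection (E (cylinder m w))"
  shows "E (cylinder m (w @ [j])) = A w j"
proof -
  have S: "cyl_sqrt m E w = E (cylinder m w)"
    by (simp add: cyl_sqrt_def op_sqrt_projection[OF P])
  then have "cyl_space m E w = range (blinfun_apply (E (cylinder m w)))"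
    by (simp add: cyl_space_def orth_projection_closed_range[OF P])
  then have "op_on (range (blinfun_apply (E (cylinder m w)))) (A w j)"
    using splitting_operatorsD(2)[OF A w j] by simp
  then show ?thesis
    using splitting_operatorsD(5)[OF A w j] op_on_range_compress[OF P] S by simp
qed

lemma splitting_defect_eq_sum:
  assumes "splitting_operators m E A" and "w \<in> lists {..<m}"
  shows "splitting_defect m E A w = (\<Sum>j<m. A w j - (A w j o\<^sub>L A w j))"
  by (simp add: splitting_defect_def splitting_operatorsD(1)[OF assms] sum_subtractf)

lemma splitting_term_positive:
  assumes "splitting_operators m E A" and "w \<in> lists {..<m}" and "j < m"
  shows "positive_op (A w j - (A w j o\<^sub>L A w j))"
  using splitting_operatorsD(3,4)[OF assms(1,2)] assms(3) by (simp add: positive_op_minus_square)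

lemma splitting_defect_positive:
  assumes "splitting_operators m E A" and "w \<in> lists {..<m}"
  shows "positive_op (splitting_defect m E A w)"
  using splitting_term_positive[OF assms]
  by (auto simp: splitting_defect_eq_sum[OF assms] intro: positive_op_sum)

lemma splitting_defect_eq_zero_iff:
  assumes A: "splitting_operators m E A" and w: "w \<in> lists {..<m}"
  shows "splitting_defect m E A w = 0 \<longleftrightarrow> (\<forall>j<m. orth_projection (A w j))"
proof -
  have "splitting_defect m E A w = 0 \<longleftrightarrow> (\<forall>j<m. A w j - (A w j o\<^sub>L A w j) = 0)"
    unfolding splitting_defect_eq_sum[OF A w]
    using positive_sum_eq_zero[of "{..<m}" "\<lambda>j. A w j - (A w j o\<^sub>L A w j)"]
      splitting_term_positive[OF A w] by (auto intro: sum.neutral)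
  also have "\<dots> \<longleftrightarrow> (\<forall>j<m. orth_projection (A w j))"
    using splitting_operatorsD(3)[OF A w] by (auto simp: orth_projection_iff)
  finally show ?thesis .
qed

theorem proposition7p5:
  fixes m :: nat
    and E :: "(nat \<Rightarrow> nat) set \<Rightarrow> ('a::chilbert_space \<Rightarrow>\<^sub>L 'a)"
    and A :: "nat list \<Rightarrow> nat \<Rightarrow> ('a \<Rightarrow>\<^sub>L 'a)"
  assumes "m \<ge> 2"
    and "povm m E"
    and "splitting_operators m E A"
  shows "(\<forall>w\<in>lists {..<m}.
            splitting_defect m E A w = (\<Sum>j<m. A w j - (A w j o\<^sub>L A w j)) \<and>
            positive_op (splitting_defect m E A w) \<and>
            (splitting_defect m E A w = 0 \<longleftrightarrow> (\<forall>j<m. orth_projection (A w j)))) \<and>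
         (projection_valued m E \<longleftrightarrow> (\<forall>w\<in>lists {..<m}. splitting_defect m E A w = 0))"
proof (intro conjI ballI)
  note E = assms(2) and A = assms(3)
  fix w assume w: "w \<in> lists {..<m}"
  show "splitting_defect m E A w = (\<Sum>j<m. A w j - (A w j o\<^sub>L A w j))"
    by (rule splitting_defect_eq_sum[OF A w])
  show "positive_op (splitting_defect m E A w)"
    by (rule splitting_defect_positive[OF A w])
  show "splitting_defect m E A w = 0 \<longleftrightarrow> (\<forall>j<m. orth_projection (A w j))"
    by (rule splitting_defect_eq_zero_iff[OF A w])
next
  note E = assms(2) and A = assms(3)
  show "projection_valued m E \<longleftrightarrow> (\<forall>w\<in>lists {..<m}. splitting_defect m E A w = 0)"
  proof
    assume pv: "projection_valued m E"
    have cyl: "orth_projection (E (cylinder m w))" for w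
      using pv cylinder_in_sets by (auto simp: projection_valued_def)
    show "\<forall>w\<in>lists {..<m}. splitting_defect m E A w = 0"
    proof
      fix w assume w: "w \<in> lists {..<m}"
      have "orth_projection (A w j)" if "j < m" for j
        using splitting_operators_eq_measure[OF A w that cyl] cyl by metis
      then show "splitting_defect m E A w = 0"
        using splitting_defect_eq_zero_iff[OF A w] by blast
    qed
  next
    assume zero: "\<forall>w\<in>lists {..<m}. splitting_defect m E A w = 0"
    have "orth_projection (E (cylinder m w))" if "w \<in> lists {..<m}" for w
      using that
    proof (induction w rule: rev_induct)
      case Nil
      show ?case by (simp add: cylinder_Nil povm_space[OF E] orth_projection_id)
    next
      case (snoc j w)
      then have w: "w \<in> lists {..<m}" and j: "j < m" by auto
      have "E (cylinder m (w @ [j])) = A w j"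
        by (rule splitting_operators_eq_measure[OF A w j snoc.IH[OF w]])
      then show ?case
        using zero splitting_defect_eq_zero_iff[OF A w] w j by auto
    qed
    then show "projection_valued m E"
      by (rule projection_valued_if_cylinders[OF E])
  qed
qed

end
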